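(* Let $B$ be the adjacency matrix of a regular graph $G_B$ on $4$ vertices. For each $n$, let $C_n$ be the adjacency matrix of a graph $G_{C_n}$ on $n$ vertices which has minimum degree at least $1$ (resp. at least $2$). Call a $4\times n$ $0$-$1$ matrix $N$ GM-admissible if each of its columns has exactly $0$, $2$ or $4$ ones. For such $N$, let $G$ be the labeled graph with adjacency matrix $\begin{bmatrix} B & N \\ N^t & C_n\end{bmatrix}$ and $\tilde G$ the labeled graph with adjacency matrix $\begin{bmatrix} B & \tilde N \\ \tilde N^t & C_n\end{bmatrix}$, where $\tilde N$ is obtained from $N$ by replacing each column $\mathbf v$ containing exactly two ones by $\mathbf{1}-\mathbf v$. Then the proportion of GM-admissible $N$ (among all $8^n$ of them) for which $Z_{G^*}\ne Z_{\tilde G^*}$ (resp. $Z_G \ne Z_{\tilde G}$) tends to $1$ as $n\to\infty$.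
   Context: Graphs are finite and simple. $Z_G$ denotes the Ihara zeta function: for a graph $G$ with adjacency matrix $A$, degree matrix $D$, $n_G$ vertices and $m_G$ edges, $Z_G(t)=(1-t^2)^{n_G-m_G}\det(I-tA+t^2(D-I))^{-1}$; equivalently $Z_G(t)=\prod_{[\gamma]}(1-t^{\ell(\gamma)})^{-1}$ over cyclic-rotation classes of primitive closed geodesics $\gamma$ (closed walks without backtracking $e_{i+1}= e_i^{-1}$ and without tail $e_1=e_\ell^{-1}$, not a power of a shorter one). The cone $G^*$ is $G$ together with a new vertex adjacent to every vertex of $G$. *)

theory Defs
  imports "Jordan_Normal_Form.Determinant" "HOL-Computational_Algebra.Formal_Power_Series"
begin

definition is_adj_mat :: "int mat \<Rightarrow> bool" where
  "is_adj_mat A \<longleftrightarrow> A \<in> carrier_mat (dim_row A) (dim_row A) \<and>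
     (\<forall>i < dim_row A. \<forall>j < dim_row A. A $$ (i,j) \<in> {0,1} \<and> A $$ (i,j) = A $$ (j,i)) \<and>
     (\<forall>i < dim_row A. A $$ (i,i) = 0)"

definition vdeg :: "int mat \<Rightarrow> nat \<Rightarrow> int" where
  "vdeg A i = (\<Sum>j < dim_col A. A $$ (i,j))"

definition num_edges :: "int mat \<Rightarrow> int" where
  "num_edges A = (\<Sum>i < dim_row A. vdeg A i) div 2"

definition is_regular :: "int mat \<Rightarrow> bool" where
  "is_regular A \<longleftrightarrow> (\<exists>k. \<forall>i < dim_row A. vdeg A i = k)"

definition min_deg_ge :: "int mat \<Rightarrow> int \<Rightarrow> bool" where
  "min_deg_ge A d \<longleftrightarrow> (\<forall>i < dim_row A. vdeg A i \<ge> d)"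

definition ihara_det :: "int mat \<Rightarrow> real fps" where
  "ihara_det A = det (mat (dim_row A) (dim_row A) (\<lambda>(i,j).
      (if i = j then 1 else 0) - fps_X * of_int (A $$ (i,j))
      + fps_X ^ 2 * (if i = j then of_int (vdeg A i) - 1 else 0)))"

definition ihara_zeta :: "int mat \<Rightarrow> real fps" where
  "ihara_zeta A = (let n = int (dim_row A); m = num_edges A in
     (if m \<le> n then (1 - fps_X ^ 2) ^ nat (n - m)
      else inverse ((1 - fps_X ^ 2) ^ nat (m - n))) * inverse (ihara_det A))"

definition cone :: "int mat \<Rightarrow> int mat" where
  "cone A = four_block_mat A (mat (dim_row A) 1 (\<lambda>_. 1)) (mat 1 (dim_row A) (\<lambda>_. 1)) (0\<^sub>m 1 1)"

definition col_ones :: "int mat \<Rightarrow> nat \<Rightarrow> int" where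
  "col_ones N j = (\<Sum>i < dim_row N. N $$ (i,j))"

definition GM_admissible :: "nat \<Rightarrow> int mat set" where
  "GM_admissible n = {N. N \<in> carrier_mat 4 n \<and>
      (\<forall>i < 4. \<forall>j < n. N $$ (i,j) \<in> {0,1}) \<and>
      (\<forall>j < n. col_ones N j \<in> {0,2,4})}"

definition GM_switch :: "int mat \<Rightarrow> int mat" where
  "GM_switch N = mat (dim_row N) (dim_col N) (\<lambda>(i,j).
      if col_ones N j = 2 then 1 - N $$ (i,j) else N $$ (i,j))"

definition block_graph :: "int mat \<Rightarrow> int mat \<Rightarrow> int mat \<Rightarrow> int mat" where
  "block_graph B N C = four_block_mat B N (transpose_mat N) C"

end

theory Submission
  imports Defs "HOL-Library.FuncSet"
begin

text \<open>
  Equal zeta functions (with equal numbers of vertices and edges) have equal top coefficients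
  \<open>\<Prod>(d\<^sub>i - 1)\<close> of their determinants. Under the degree hypotheses the factors of the vertices outside
  \<open>B\<close> are nonzero and unaffected by switching, so only the four vertices of \<open>B\<close> matter. Switching
  replaces their row sums \<open>r\<^sub>i\<close> by \<open>h - r\<^sub>i\<close>, where \<open>2h = r\<^sub>1 + r\<^sub>2 + r\<^sub>3 + r\<^sub>4\<close>, and the difference of the two products
  of four factors is a multiple of \<open>(r\<^sub>1 + r\<^sub>2 - h)(r\<^sub>1 + r\<^sub>3 - h)(r\<^sub>2 + r\<^sub>3 - h)\<close>. Each of these three factors is a
  lazy random walk in the number of columns, hence vanishes with probability tending to \<open>0\<close>.
\<close>

section \<open>Top coefficient of the Ihara determinant\<close>

text \<open>Leading coefficients multiply for polynomials of degree at most \<open>d\<close>.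
  Vanishing above \<open>d * card S\<close> is proved alongside because the induction needs it to
  discard the other convolution terms.\<close>

lemma fps_nth_prod_top:
  fixes f :: "'a \<Rightarrow> 'b :: comm_ring_1 fps"
  assumes "finite S" and "\<And>i k. i \<in> S \<Longrightarrow> k > d \<Longrightarrow> fps_nth (f i) k = 0"
  shows "(\<forall>k > d * card S. fps_nth (prod f S) k = 0) \<and>
    fps_nth (prod f S) (d * card S) = (\<Prod>i\<in>S. fps_nth (f i) d)"
  using assms
proof (induction S rule: finite_induct)
  case empty
  show ?case by auto
next
  case (insert x F)
  let ?c = "d * card F"
  have high: "fps_nth (prod f F) k = 0" if "k > ?c" for k
    using insert that by simp
  have top: "fps_nth (prod f F) ?c = (\<Prod>i\<in>F. fps_nth (f i) d)"
    using insert by simp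
  \<comment> \<open>For \<open>k \<ge> d + ?c\<close>, an index \<open>i > d\<close> kills the first
    factor and \<open>i < d\<close> pushes \<open>k - i\<close> above \<open>?c\<close>, so only
    \<open>i = d\<close> with \<open>k = d + ?c\<close> can survive.\<close>
  have summand: "fps_nth (f x) i * fps_nth (prod f F) (k - i) =
      (if i = d \<and> k = d + ?c then fps_nth (f x) d * (\<Prod>i\<in>F. fps_nth (f i) d) else 0)"
    if "k \<ge> d + ?c" "i \<le> k" for i k
  proof (cases "i > d")
    case True
    then show ?thesis using insert.prems by simp
  next
    case False
    then show ?thesis using that top high[of "k - i"] by (cases "k - i > ?c") auto
  qed
  have "fps_nth (prod f (insert x F)) k =
      (if k = d + ?c then fps_nth (f x) d * (\<Prod>i\<in>F. fps_nth (f i) d) else 0)"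
    if "k \<ge> d + ?c" for k
  proof -
    have "fps_nth (prod f (insert x F)) k =
        (\<Sum>i = 0..k. fps_nth (f x) i * fps_nth (prod f F) (k - i))"
      using insert by (simp add: fps_mult_nth)
    also have "\<dots> = (\<Sum>i = 0..k. if i = d \<and> k = d + ?c
        then fps_nth (f x) d * (\<Prod>i\<in>F. fps_nth (f i) d) else 0)"
      using summand that by (intro sum.cong) auto
    also have "\<dots> = (if k = d + ?c then fps_nth (f x) d * (\<Prod>i\<in>F. fps_nth (f i) d) else 0)"
      by (cases "k = d + ?c") auto
    finally show ?thesis .
  qed
  then show ?case using insert by (auto simp: algebra_simps)
qed

lemma fps_nth_signof_mult: "fps_nth (of_int (sign p) * f) k = of_int (sign p) * fps_nth f k"
  for f :: "'a :: comm_ring_1 fps"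
  by (cases p rule: sign_cases) auto

text \<open>Each Leibniz term is, up to sign, a product of \<open>n\<close> entries of degree at
  most \<open>d\<close>, so extracting coefficient \<open>d * n\<close> amounts to extracting
  coefficient \<open>d\<close> from every entry.\<close>

lemma fps_nth_det_top:
  fixes M :: "'a :: comm_ring_1 fps mat"
  assumes M: "M \<in> carrier_mat n n"
    and deg: "\<And>i j k. i < n \<Longrightarrow> j < n \<Longrightarrow> k > d \<Longrightarrow> fps_nth (M $$ (i,j)) k = 0"
  shows "fps_nth (det M) (d * n) = det (map_mat (\<lambda>f. fps_nth f d) M)"
proof -
  have "fps_nth (\<Prod>i = 0..<n. M $$ (i, p i)) (d * n) = (\<Prod>i = 0..<n. fps_nth (M $$ (i, p i)) d)"
    if "p permutes {0..<n}" for p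
  proof -
    have "p i < n" if "i < n" for i
      using permutes_in_image[OF \<open>p permutes {0..<n}\<close>, of i] that by auto
    then show ?thesis
      using fps_nth_prod_top[of "{0..<n}" d "\<lambda>i. M $$ (i, p i)"] deg by auto
  qed
  moreover have "map_mat (\<lambda>f. fps_nth f d) M $$ (i, p i) = fps_nth (M $$ (i, p i)) d"
    if "p permutes {0..<n}" "i < n" for p i
    using permutes_in_image[OF that(1), of i] that M by auto
  ultimately show ?thesis
    using M by (simp add: det_def'[of _ n] fps_sum_nth fps_nth_signof_mult)
qed

lemma det_diagonal:
  fixes f :: "nat \<Rightarrow> 'a :: comm_ring_1"
  shows "det (mat n n (\<lambda>(i,j). if i = j then f i else 0)) = (\<Prod>i<n. f i)"
proof -
  let ?D = "mat n n (\<lambda>(i,j). if i = j then f i else 0)"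
  have "det ?D = prod_list (diag_mat ?D)"
    by (rule det_upper_triangular) auto
  also have "\<dots> = (\<Prod>i<n. f i)"
    unfolding prod_list_diag_prod by (rule prod.cong) auto
  finally show ?thesis .
qed

lemma hom_fps_nth_0: "comm_ring_hom (\<lambda>f :: 'a :: comm_ring_1 fps. fps_nth f 0)"
  by unfold_locales auto

lemma fps_nth_of_int: "fps_nth (of_int c) k = (if k = 0 then of_int c else 0)"
  by (simp flip: fps_of_int)

lemma ihara_det_nth_0: "fps_nth (ihara_det A) 0 = 1"
proof -
  interpret comm_ring_hom "\<lambda>f :: real fps. fps_nth f 0" by (rule hom_fps_nth_0)
  have "fps_nth (ihara_det A) 0 = det (1\<^sub>m (dim_row A) :: real mat)"
    unfolding ihara_det_def hom_det[symmetric] by (rule arg_cong[of _ _ det], rule eq_matI) auto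
  then show ?thesis by simp
qed

text \<open>The quadratic coefficient of \<open>I - tA + t^2(D - I)\<close> is the diagonal matrix
  \<open>D - I\<close>.\<close>

lemma ihara_det_nth_top:
  "fps_nth (ihara_det A) (2 * dim_row A) = of_int (\<Prod>i<dim_row A. vdeg A i - 1)"
proof -
  let ?n = "dim_row A"
  let ?M = "mat ?n ?n (\<lambda>(i,j).
      (if i = j then 1 else 0) - fps_X * of_int (A $$ (i,j))
      + fps_X ^ 2 * (if i = j then of_int (vdeg A i) - 1 else 0)) :: real fps mat"
  have "fps_nth (?M $$ (i,j)) k = 0" if "i < ?n" "j < ?n" "k > 2" for i j k
    using that by (auto simp: fps_X_power_mult_nth fps_nth_of_int)
  then have "fps_nth (det ?M) (2 * ?n) = det (map_mat (\<lambda>f. fps_nth f 2) ?M)"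
    by (intro fps_nth_det_top) auto
  also have "map_mat (\<lambda>f. fps_nth f 2) ?M =
      mat ?n ?n (\<lambda>(i,j). if i = j then of_int (vdeg A i - 1) else 0)"
    by (rule eq_matI) (auto simp: fps_X_power_mult_nth fps_nth_of_int)
  finally show ?thesis
    by (simp add: ihara_det_def det_diagonal)
qed

text \<open>Equal vertex and edge counts give both zeta functions the same prefactor, a nonzero
  series; cancelling it leaves equal determinants, whose top coefficients are compared.\<close>

lemma ihara_zeta_eqD:
  assumes eq: "ihara_zeta A = ihara_zeta A'"
    and dim: "dim_row A = dim_row A'" and edges: "num_edges A = num_edges A'"
  shows "(\<Prod>i<dim_row A. vdeg A i - 1) = (\<Prod>i<dim_row A'. vdeg A' i - 1)"
proof -
  define F :: "real fps" where "F = (let n = int (dim_row A); m = num_edges A in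
     (if m \<le> n then (1 - fps_X ^ 2) ^ nat (n - m)
      else inverse ((1 - fps_X ^ 2) ^ nat (m - n))))"
  have "fps_nth F 0 \<noteq> 0"
    by (simp add: F_def Let_def fps_power_zeroth)
  then have "F \<noteq> 0" by auto
  moreover have "F * inverse (ihara_det A) = F * inverse (ihara_det A')"
    using eq unfolding ihara_zeta_def F_def Let_def dim edges .
  ultimately have "inverse (inverse (ihara_det A)) = inverse (inverse (ihara_det A'))"
    by simp
  \<comment> \<open>Constant coefficient 1 makes both determinants units, so inverting twice gives
    them back.\<close>
  then have "ihara_det A = ihara_det A'"
    by (simp add: ihara_det_nth_0)
  then have "real_of_int (\<Prod>i<dim_row A. vdeg A i - 1) = of_int (\<Prod>i<dim_row A'. vdeg A' i - 1)"
    using dim by (metis ihara_det_nth_top)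
  then show ?thesis by (simp only: of_int_eq_iff)
qed

section \<open>Return probabilities of integer random walks\<close>

text \<open>Strict triangle inequality for distinct unit vectors, read off from the squared norm
  \<open>2 + 2 * cos (a - b)\<close>.\<close>

lemma norm_cis_add_less:
  assumes "cos (a - b) \<noteq> 1"
  shows "norm (cis a + cis b) < 2"
proof -
  have "(norm (cis a + cis b))\<^sup>2 = (cos a + cos b)\<^sup>2 + (sin a + sin b)\<^sup>2"
    by (simp add: cmod_power2)
  also have "\<dots> = 2 + 2 * cos (a - b)"
  proof -
    have "(x + y)\<^sup>2 + (z + w)\<^sup>2 = (z\<^sup>2 + x\<^sup>2) + (w\<^sup>2 + y\<^sup>2) + 2 * (x * y + z * w)"
      for x y z w :: real
      by (simp add: power2_eq_square algebra_simps)
    then show ?thesis by (simp add: cos_diff)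
  qed
  also have "\<dots> < 2\<^sup>2"
    using order.not_eq_order_implies_strict[OF assms cos_le_one] by simp
  finally show ?thesis
    by (rule power2_less_imp_less) simp
qed

text \<open>Orthogonality of the characters of the integers modulo \<open>M\<close>: the sum is
  geometric with a ratio \<open>z\<close> satisfying \<open>z ^ M = 1\<close>, hence vanishes unless
  \<open>z = 1\<close>.\<close>

lemma sum_cis_roots_of_unity:
  fixes D :: int
  assumes "M > 0"
  shows "(\<Sum>j<M. cis (2 * pi * real j * of_int D / real M)) =
    (if int M dvd D then of_nat M else 0)"
proof -
  define z where "z = cis (2 * pi * of_int D / real M)"
  have sum: "(\<Sum>j<M. cis (2 * pi * real j * of_int D / real M)) = (\<Sum>j<M. z ^ j)"
    by (rule sum.cong) (auto simp: z_def DeMoivre field_simps)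
  have zM: "z ^ M = 1"
    using assms by (simp add: z_def DeMoivre)
  have z1: "z = 1 \<longleftrightarrow> int M dvd D"
  proof
    assume "z = 1"
    then have "cos (2 * pi * of_int D / real M) = 1"
      by (metis z_def cis.sel(1) one_complex.sel(1))
    then obtain k :: int where "2 * pi * of_int D / real M = of_int k * 2 * pi"
      using cos_one_2pi_int by blast
    then have "of_int D = real_of_int (k * int M)"
      using assms by (simp add: field_simps)
    then have "D = k * int M" by (simp only: of_int_eq_iff)
    then show "int M dvd D" by simp
  next
    assume "int M dvd D"
    then obtain k where "D = int M * k" by (auto simp: dvd_def)
    then show "z = 1"
      using assms cis_multiple_2pi[of "of_int k"] by (simp add: z_def mult.assoc)
  qed
  show ?thesis
  proof (cases "z = 1")
    case True
    then show ?thesis using z1 sum by simp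
  next
    case False
    then show ?thesis using z1 sum zM by (simp add: geometric_sum)
  qed
qed

text \<open>
  Averaging the characteristic function of the walk over the \<open>M\<close>-th roots of unity bounds the
  return probability. All terms but the one at \<open>1\<close> decay, so the limit superior is at most \<open>1/M\<close>.
\<close>

lemma walk_return_tendsto_0:
  fixes d :: "'a \<Rightarrow> int"
  assumes W: "finite W" and v: "v \<in> W" and w: "w \<in> W" and vw: "d v = d w + 1"
  shows "(\<lambda>n. real (card {g \<in> {..<n} \<rightarrow>\<^sub>E W. (\<Sum>j<n. d (g j)) = 0}) / real (card W) ^ n)
    \<longlonglongrightarrow> 0"
proof (rule LIMSEQ_I)
  fix e :: real
  assume "e > 0"
  then obtain M :: nat where M: "M > 0" "1 / real M < e"
    using reals_Archimedean by (metis inverse_eq_divide of_nat_Suc zero_less_Suc)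
  \<comment> \<open>\<open>\<phi> j\<close> is the unnormalised characteristic function of one step
    at the \<open>j\<close>-th power of the primitive \<open>M\<close>-th root of unity;
    \<open>a j u\<close> is the phase contributed by the step \<open>u\<close>.\<close>
  define a where "a j u = 2 * pi * real j * of_int (d u) / real M" for j u
  define \<phi> where "\<phi> j = (\<Sum>u\<in>W. cis (a j u))" for j
  have cW: "card W > 0" using W v by (auto simp: card_gt_0_iff)
  have \<phi>_less: "norm (\<phi> j) / real (card W) < 1" if "0 < j" "j < M" for j
  proof -
    have "v \<noteq> w" using vw by auto
    \<comment> \<open>Steps differing by exactly one have phases differing by
      \<open>2 * pi * j / M\<close>, never a full turn for \<open>0 < j < M\<close>. This excludes
      periodicity and makes the bound on \<open>\<phi> j\<close> strict.\<close>
    have "a j v - a j w = 2 * pi * real j / real M"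
      using M by (simp add: a_def vw field_simps)
    moreover have "cos (2 * pi * real j / real M) \<noteq> 1"
    proof
      assume "cos (2 * pi * real j / real M) = 1"
      then obtain k :: int where "2 * pi * real j / real M = of_int k * 2 * pi"
        using cos_one_2pi_int by blast
      then have "real_of_int (int j) = real_of_int (k * int M)"
        using M by (simp add: field_simps)
      then have "int j = k * int M" by (simp only: of_int_eq_iff)
      then have "int M dvd int j" by simp
      then show False using that by (auto dest: zdvd_imp_le)
    qed
    ultimately have less: "norm (cis (a j v) + cis (a j w)) < 2"
      by (intro norm_cis_add_less) simp
    have "\<phi> j = cis (a j v) + cis (a j w) + (\<Sum>u\<in>W - {v,w}. cis (a j u))"
      using W v w \<open>v \<noteq> w\<close> sum.subset_diff[of "{v,w}" W "\<lambda>u. cis (a j u)"]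
      by (simp add: \<phi>_def)
    then have "norm (\<phi> j) \<le> norm (cis (a j v) + cis (a j w)) + (\<Sum>u\<in>W - {v,w}. norm (cis (a j u)))"
      by (metis norm_triangle_le add_left_mono norm_sum)
    also have "\<dots> < 2 + real (card (W - {v,w}))"
      using less by simp
    also have "\<dots> = real (card W)"
    proof -
      have "card {v,w} \<le> card W" using W v w by (intro card_mono) auto
      then show ?thesis
        using W v w \<open>v \<noteq> w\<close> by (subst card_Diff_subset) auto
    qed
    finally show ?thesis using cW by simp
  qed
  let ?Z = "\<lambda>n. {g \<in> {..<n} \<rightarrow>\<^sub>E W. (\<Sum>j<n. d (g j)) = 0}"
  have bound: "real (card (?Z n)) / real (card W) ^ n \<le>
      (\<Sum>j<M. (norm (\<phi> j) / real (card W)) ^ n) / real M" for n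
  proof -
    let ?P = "{..<n} \<rightarrow>\<^sub>E W"
    have finP: "finite ?P" using W by (intro finite_PiE) auto
    \<comment> \<open>Expanding the power yields one term per walk of length \<open>n\<close>, since
      phases add up along a walk.\<close>
    have pow: "\<phi> j ^ n = (\<Sum>g\<in>?P. cis (2 * pi * real j * of_int (\<Sum>i<n. d (g i)) / real M))" for j
    proof -
      have cis_sum: "(\<Prod>i<m. cis (x i)) = cis (\<Sum>i<m. x i)" for x :: "nat \<Rightarrow> real" and m
        by (induction m) (auto simp: cis_mult)
      have "\<phi> j ^ n = (\<Prod>i<n. \<Sum>u\<in>W. cis (a j u))"
        by (simp add: \<phi>_def)
      also have "\<dots> = (\<Sum>g\<in>?P. \<Prod>i<n. cis (a j (g i)))"
        using W by (intro prod_sum_PiE) auto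
      also have "\<dots> = (\<Sum>g\<in>?P. cis (2 * pi * real j * of_int (\<Sum>i<n. d (g i)) / real M))"
        by (simp add: cis_sum a_def sum_distrib_left sum_divide_distrib)
      finally show ?thesis .
    qed
    have "real (card (?Z n)) * real M = (\<Sum>g\<in>?P. if (\<Sum>i<n. d (g i)) = 0 then real M else 0)"
      using finP by (simp add: sum.If_cases Int_def)
    \<comment> \<open>The character sum detects every endpoint divisible by \<open>M\<close>, not
      only \<open>0\<close>; this is where equality is lost.\<close>
    also have "\<dots> \<le> (\<Sum>g\<in>?P. Re (\<Sum>j<M. cis (2 * pi * real j * of_int (\<Sum>i<n. d (g i)) / real M)))"
      by (rule sum_mono, subst sum_cis_roots_of_unity[OF M(1)]) auto
    also have "\<dots> = Re (\<Sum>j<M. \<phi> j ^ n)"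
      unfolding pow Re_sum by (rule sum.swap)
    also have "\<dots> \<le> norm (\<Sum>j<M. \<phi> j ^ n)"
      by (rule complex_Re_le_cmod)
    also have "\<dots> \<le> (\<Sum>j<M. norm (\<phi> j) ^ n)"
      by (rule order_trans[OF norm_sum]) (simp add: norm_power)
    finally show ?thesis
      using M cW by (simp add: power_divide sum_divide_distrib[symmetric] field_simps)
  qed
  \<comment> \<open>As \<open>\<phi> 0\<close> equals \<open>card W\<close>, the term
    \<open>j = 0\<close> stays at 1; the others are geometric with ratio below 1.\<close>
  have "(\<lambda>n. (\<Sum>j<M. (norm (\<phi> j) / real (card W)) ^ n) / real M)
      \<longlonglongrightarrow> (\<Sum>j<M. if j = 0 then 1 else 0) / real M"
  proof (intro tendsto_divide tendsto_const tendsto_sum)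
    fix j assume "j \<in> {..<M}"
    show "(\<lambda>n. (norm (\<phi> j) / real (card W)) ^ n) \<longlonglongrightarrow> (if j = 0 then 1 else 0)"
    proof (cases "j = 0")
      case True
      then show ?thesis using cW by (simp add: \<phi>_def a_def)
    next
      case False
      then show ?thesis
        using \<phi>_less[of j] \<open>j \<in> {..<M}\<close> by (auto intro!: LIMSEQ_realpow_zero)
    qed
  qed (use M in auto)
  then have "(\<lambda>n. (\<Sum>j<M. (norm (\<phi> j) / real (card W)) ^ n) / real M) \<longlonglongrightarrow> 1 / real M"
    using M by simp
  then have "\<forall>\<^sub>F n in sequentially. (\<Sum>j<M. (norm (\<phi> j) / real (card W)) ^ n) / real M < e"
    using M(2) by (rule order_tendstoD)
  then obtain n0 where "\<And>n. n \<ge> n0 \<Longrightarrow> (\<Sum>j<M. (norm (\<phi> j) / real (card W)) ^ n) / real M < e"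
    by (auto simp: eventually_sequentially)
  then show "\<exists>n0. \<forall>n\<ge>n0. norm (real (card (?Z n)) / real (card W) ^ n - 0) < e"
    using bound by (intro exI[of _ n0]) (auto intro: le_less_trans)
qed

section \<open>Degrees under Godsil--McKay switching\<close>

lemma sum_lessThan_4: "(\<Sum>i<4. f i) = f 0 + f 1 + f 2 + f (3::nat)"
  for f :: "nat \<Rightarrow> 'a :: comm_monoid_add"
  by (simp add: eval_nat_numeral)

lemma prod_lessThan_4: "(\<Prod>i<4. f i) = f 0 * f 1 * f 2 * f (3::nat)"
  for f :: "nat \<Rightarrow> 'a :: comm_monoid_mult"
  by (simp add: eval_nat_numeral)

lemma less_4_cases: "i < (4::nat) \<longleftrightarrow> i = 0 \<or> i = 1 \<or> i = 2 \<or> i = 3"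
  by auto

lemma sum_lessThan_add: "(\<Sum>i<m + n. f i) = (\<Sum>i<m. f i) + (\<Sum>j<n. f (m + j))"
  for f :: "nat \<Rightarrow> 'a :: comm_monoid_add"
  by (induction n) (auto simp: add.assoc)

lemma prod_lessThan_add: "(\<Prod>i<m + n. f i) = (\<Prod>i<m. f i) * (\<Prod>j<n. f (m + j))"
  for f :: "nat \<Rightarrow> 'a :: comm_monoid_mult"
  by (induction n) (auto simp: mult.assoc)

section \<open>Degrees of block graphs and cones\<close>

lemma dim_block_graph:
  assumes "B \<in> carrier_mat m m" "C \<in> carrier_mat n n"
  shows "dim_row (block_graph B N C) = m + n" "dim_col (block_graph B N C) = m + n"
  using assms by (auto simp: block_graph_def)

text \<open>\<open>vdeg\<close> sums over \<open>dim_col\<close>, so on the rectangular matrix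
  \<open>N\<close> it gives the row sums.\<close>

lemma vdeg_block_graph:
  assumes "B \<in> carrier_mat m m" "N \<in> carrier_mat m n" "C \<in> carrier_mat n n"
  shows "i < m \<Longrightarrow> vdeg (block_graph B N C) i = vdeg B i + vdeg N i"
    and "j < n \<Longrightarrow> vdeg (block_graph B N C) (m + j) = col_ones N j + vdeg C j"
  using assms unfolding vdeg_def col_ones_def
  by (auto simp: dim_block_graph sum_lessThan_add) (auto simp: block_graph_def)

lemma dim_cone: "dim_row (cone A) = dim_row A + 1" "dim_col (cone A) = dim_col A + 1"
  by (auto simp: cone_def)

lemma vdeg_cone:
  assumes "A \<in> carrier_mat n n"
  shows "i < n \<Longrightarrow> vdeg (cone A) i = vdeg A i + 1"
    and "vdeg (cone A) n = int n"
  using assms unfolding vdeg_def by (auto simp: dim_cone) (auto simp: cone_def)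

lemma sum_vdeg_cone:
  assumes "A \<in> carrier_mat n n"
  shows "(\<Sum>i<dim_row (cone A). vdeg (cone A) i) = (\<Sum>i<n. vdeg A i) + 2 * int n"
  using assms by (simp add: dim_cone vdeg_cone[OF assms] sum.distrib)

text \<open>The edge to the apex offsets the \<open>- 1\<close>, leaving the degrees of
  \<open>A\<close> themselves; hence minimum degree 1 suffices for cones. The last factor comes from
  the apex.\<close>

lemma prod_vdeg_cone:
  assumes "A \<in> carrier_mat n n"
  shows "(\<Prod>i<dim_row (cone A). vdeg (cone A) i - 1) = (\<Prod>i<n. vdeg A i) * (int n - 1)"
  using assms by (simp add: dim_cone vdeg_cone[OF assms])

section \<open>Admissible matrices as sequences of columns\<close>

definition gm_columns :: "(int \<times> int \<times> int \<times> int) set" where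
  "gm_columns = {(0,0,0,0), (1,1,0,0), (1,0,1,0), (1,0,0,1),
     (0,1,1,0), (0,1,0,1), (0,0,1,1), (1,1,1,1)}"

lemma gm_columns_iff:
  "(a,b,c,e) \<in> gm_columns \<longleftrightarrow> {a,b,c,e} \<subseteq> {0,1} \<and> a + b + c + e \<in> {0,2,4}"
proof
  assume "(a,b,c,e) \<in> gm_columns"
  then show "{a,b,c,e} \<subseteq> {0,1} \<and> a + b + c + e \<in> {0,2,4}"
    unfolding gm_columns_def by (elim insertE emptyE) auto
next
  assume *: "{a,b,c,e} \<subseteq> {0,1} \<and> a + b + c + e \<in> {0,2,4}"
  then have "a = 0 \<or> a = 1" "b = 0 \<or> b = 1" "c = 0 \<or> c = 1" "e = 0 \<or> e = 1"
    by auto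
  then show "(a,b,c,e) \<in> gm_columns"
    using * by (elim disjE) (simp_all add: gm_columns_def)
qed

lemma finite_gm_columns: "finite gm_columns" and card_gm_columns: "card gm_columns = 8"
  by (auto simp: gm_columns_def)

text \<open>Restricting to \<open>{..<n}\<close> makes the function extensional, so admissible
  matrices correspond exactly to elements of \<open>{..<n} \<rightarrow>\<^sub>E gm_columns\<close>:
  a uniform \<open>N\<close> becomes \<open>n\<close> independent uniform columns.\<close>

definition column_fun :: "nat \<Rightarrow> int mat \<Rightarrow> nat \<Rightarrow> int \<times> int \<times> int \<times> int" where
  "column_fun n N = (\<lambda>j\<in>{..<n}. (N $$ (0,j), N $$ (1,j), N $$ (2,j), N $$ (3,j)))"

lemma GM_admissible_iff_columns:
  "N \<in> GM_admissible n \<longleftrightarrow> N \<in> carrier_mat 4 n \<and> column_fun n N \<in> {..<n} \<rightarrow>\<^sub>E gm_columns"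
  unfolding GM_admissible_def column_fun_def col_ones_def
  by (auto simp: PiE_iff gm_columns_iff less_4_cases sum_lessThan_4 carrier_matD)

lemma bij_betw_column_fun:
  "bij_betw (column_fun n) (GM_admissible n) ({..<n} \<rightarrow>\<^sub>E gm_columns)"
proof (rule bij_betw_byWitness)
  define G where "G g = mat 4 n (\<lambda>(i,j). case g j of (a,b,c,e) \<Rightarrow>
    if i = 0 then a else if i = 1 then b else if i = 2 then c else e)"
    for g :: "nat \<Rightarrow> int \<times> int \<times> int \<times> int"
  have inv: "column_fun n (G g) = g" if "g \<in> {..<n} \<rightarrow>\<^sub>E gm_columns" for g
  proof
    fix j
    show "column_fun n (G g) j = g j"
      using that by (cases "j < n") (auto simp: column_fun_def G_def PiE_iff extensional_def split: prod.splits)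
  qed
  then show "\<forall>g\<in>{..<n} \<rightarrow>\<^sub>E gm_columns. column_fun n (G g) = g" by blast
  show "\<forall>N\<in>GM_admissible n. G (column_fun n N) = N"
    by (auto simp: GM_admissible_def G_def column_fun_def less_4_cases intro!: eq_matI)
  show "column_fun n ` GM_admissible n \<subseteq> {..<n} \<rightarrow>\<^sub>E gm_columns"
    using GM_admissible_iff_columns by blast
  show "G ` ({..<n} \<rightarrow>\<^sub>E gm_columns) \<subseteq> GM_admissible n"
    using inv by (auto simp: GM_admissible_iff_columns) (auto simp: G_def)
qed

lemma finite_GM_admissible: "finite (GM_admissible n)"
  using bij_betw_finite[OF bij_betw_column_fun[of n]] finite_gm_columns
  by (simp add: finite_PiE)

lemma card_GM_admissible: "card (GM_admissible n) = 8 ^ n"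
  using bij_betw_same_card[OF bij_betw_column_fun[of n]]
  by (simp add: card_PiE card_gm_columns)

section \<open>Row and column sums under switching\<close>

lemma GM_switch_carrier: "N \<in> carrier_mat m n \<Longrightarrow> GM_switch N \<in> carrier_mat m n"
  by (auto simp: GM_switch_def)

text \<open>Replacing \<open>x\<close> by \<open>col_ones N j / 2 - x\<close> describes all column
  types at once: it complements columns with two ones and fixes constant columns. Doubling avoids
  the division.\<close>

lemma GM_switch_entry:
  assumes N: "N \<in> GM_admissible n" and "i < 4" "j < n"
  shows "2 * GM_switch N $$ (i,j) = col_ones N j - 2 * N $$ (i,j)"
proof -
  have "N \<in> carrier_mat 4 n" using N by (simp add: GM_admissible_def)
  moreover have "N $$ (0,j) \<in> {0,1}" "N $$ (1,j) \<in> {0,1}" "N $$ (2,j) \<in> {0,1}" "N $$ (3,j) \<in> {0,1}"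
    "col_ones N j \<in> {0,2,4}"
    using N \<open>j < n\<close> by (auto simp: GM_admissible_def)
  ultimately show ?thesis
    using assms(2,3) by (auto simp: GM_switch_def col_ones_def sum_lessThan_4 less_4_cases)
qed

lemma col_ones_GM_switch:
  assumes N: "N \<in> GM_admissible n" and "j < n"
  shows "col_ones (GM_switch N) j = col_ones N j"
proof -
  have N4: "N \<in> carrier_mat 4 n" using N by (simp add: GM_admissible_def)
  have "2 * col_ones (GM_switch N) j = (\<Sum>i<4. 2 * GM_switch N $$ (i,j))"
    using GM_switch_carrier[OF N4] by (simp add: col_ones_def sum_distrib_left)
  also have "\<dots> = (\<Sum>i<4. col_ones N j - 2 * N $$ (i,j))"
    by (rule sum.cong) (auto simp: GM_switch_entry[OF N _ \<open>j < n\<close>])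
  also have "\<dots> = 4 * col_ones N j - 2 * col_ones N j"
    using N4 by (simp add: col_ones_def sum_subtractf sum_distrib_left)
  finally show ?thesis by simp
qed

text \<open>Here \<open>h\<close> is half the number of ones in \<open>N\<close>, and the switched
  row sums follow by adding the entry formula over the columns. The signs together confine each row
  sum to the range from \<open>0\<close> to \<open>h\<close>.\<close>

lemma GM_row_sums:
  assumes N: "N \<in> GM_admissible n"
  obtains h where "h \<ge> 0" "\<And>i. i < 4 \<Longrightarrow> vdeg N i \<ge> 0"
    "\<And>i. i < 4 \<Longrightarrow> vdeg (GM_switch N) i = h - vdeg N i"
    "\<And>i. i < 4 \<Longrightarrow> vdeg (GM_switch N) i \<ge> 0"
    "(\<Sum>i<4. vdeg N i) = 2 * h"
proof -
  have N4: "N \<in> carrier_mat 4 n" using N by (simp add: GM_admissible_def)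
  have S4: "GM_switch N \<in> carrier_mat 4 n" using GM_switch_carrier[OF N4] .
  have entry: "N $$ (i,j) \<in> {0,1}" if "i < 4" "j < n" for i j
    using N that by (auto simp: GM_admissible_def)
  have col: "col_ones N j \<in> {0,2,4}" if "j < n" for j
    using N that by (auto simp: GM_admissible_def)
  define h where "h = (\<Sum>j<n. col_ones N j div 2)"
  have h2: "2 * h = (\<Sum>j<n. col_ones N j)"
    unfolding h_def sum_distrib_left using col by (intro sum.cong) force+
  show ?thesis
  proof
    show "h \<ge> 0" unfolding h_def by (rule sum_nonneg) (use col in force)
    show "vdeg N i \<ge> 0" if "i < 4" for i
      unfolding vdeg_def using N4 entry[OF that] by (intro sum_nonneg) force
    show "vdeg (GM_switch N) i = h - vdeg N i" if "i < 4" for i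
    proof -
      have "2 * vdeg (GM_switch N) i = (\<Sum>j<n. col_ones N j - 2 * N $$ (i,j))"
        unfolding vdeg_def sum_distrib_left using S4 GM_switch_entry[OF N that]
        by (intro sum.cong) auto
      also have "\<dots> = 2 * (h - vdeg N i)"
        using N4 by (simp add: sum_subtractf h2 vdeg_def sum_distrib_left)
      finally show ?thesis by simp
    qed
    show "vdeg (GM_switch N) i \<ge> 0" if "i < 4" for i
      unfolding vdeg_def
    proof (intro sum_nonneg)
      fix j assume "j \<in> {..<dim_col (GM_switch N)}"
      then show "0 \<le> GM_switch N $$ (i,j)"
        using entry[OF that, of j] N4 that by (auto simp: GM_switch_def)
    qed
    show "(\<Sum>i<4. vdeg N i) = 2 * h"
      using N4 sum.swap[of "\<lambda>i j. N $$ (i,j)" "{..<n}" "{..<4}"]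
      by (simp add: h2 vdeg_def col_ones_def)
  qed
qed

text \<open>With row sums totalling \<open>2 * h\<close>, the two products differ by
  \<open>2 * \<kappa> + h\<close> times the three balance factors. The offset
  \<open>\<kappa>\<close> allows graphs and cones to be treated together.\<close>

lemma GM_product_eq_imp_balanced:
  assumes N: "N \<in> GM_admissible n" and "\<kappa> \<ge> -1"
    and eq: "(\<Prod>i<4. \<kappa> + vdeg N i) = (\<Prod>i<4. \<kappa> + vdeg (GM_switch N) i)"
  shows "vdeg N 0 + vdeg N 1 = vdeg N 2 + vdeg N 3 \<or>
    vdeg N 0 + vdeg N 2 = vdeg N 1 + vdeg N 3 \<or>
    vdeg N 0 + vdeg N 3 = vdeg N 1 + vdeg N 2"
proof -
  obtain h where h: "h \<ge> 0" "\<And>i. i < 4 \<Longrightarrow> vdeg N i \<ge> 0"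
    "\<And>i. i < 4 \<Longrightarrow> vdeg (GM_switch N) i = h - vdeg N i"
    "\<And>i. i < 4 \<Longrightarrow> vdeg (GM_switch N) i \<ge> 0"
    "(\<Sum>i<4. vdeg N i) = 2 * h"
    using GM_row_sums[OF N] by blast
  define a b c e where "a = vdeg N 0" "b = vdeg N 1" "c = vdeg N 2" "e = vdeg N 3"
  note abce = this
  have e: "e = 2 * h - a - b - c" using h(5) by (simp add: sum_lessThan_4 abce)
  have nonneg: "0 \<le> a" "a \<le> h" "0 \<le> b" "b \<le> h" "0 \<le> c" "c \<le> h" "0 \<le> e" "e \<le> h"
    using h(2,4)[of 0] h(2,4)[of 1] h(2,4)[of 2] h(2,4)[of 3] h(3) by (auto simp: abce)
  have "(\<kappa> + a) * (\<kappa> + b) * (\<kappa> + c) * (\<kappa> + e) =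
      (\<kappa> + (h - a)) * (\<kappa> + (h - b)) * (\<kappa> + (h - c)) * (\<kappa> + (h - e))"
    using eq by (simp add: prod_lessThan_4 h(3) abce)
  moreover have "(\<kappa> + (h - a)) * (\<kappa> + (h - b)) * (\<kappa> + (h - c)) * (\<kappa> + (h - e)) -
      (\<kappa> + a) * (\<kappa> + b) * (\<kappa> + c) * (\<kappa> + e) =
      (2 * \<kappa> + h) * ((a + b - h) * (a + c - h) * (b + c - h))"
    unfolding e by (simp add: algebra_simps)
  ultimately have "(2 * \<kappa> + h) * ((a + b - h) * (a + c - h) * (b + c - h)) = 0"
    by simp
  \<comment> \<open>If the extra factor vanishes, \<open>\<kappa> \<ge> -1\<close> leaves only
    \<open>h = 0\<close> or \<open>h = 2\<close>; in both cases four integers between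
    \<open>0\<close> and \<open>h\<close> with sum \<open>2 * h\<close> split into two pairs of sum
    \<open>h\<close>.\<close>
  moreover have "a + b = h \<or> a + c = h \<or> b + c = h" if "2 * \<kappa> + h = 0"
  proof -
    have "h = 0 \<or> h = 2" using that \<open>\<kappa> \<ge> -1\<close> h(1) by presburger
    then show ?thesis using nonneg e by presburger
  qed
  ultimately have "a + b = h \<or> a + c = h \<or> b + c = h" by force
  then show ?thesis using e by (auto simp: abce)
qed

section \<open>Balanced row sums are asymptotically rare\<close>

text \<open>The signed row sum is twice a walk with steps \<open>d\<close>. Halving matters: signed
  sums of even-weight columns are even when the signs are \<open>1\<close> or \<open>-1\<close>, and
  the walk lemma needs two steps differing by one.\<close>

lemma unbalanced_tendsto_0:
  fixes s1 s2 s3 s4 :: int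
  assumes d: "\<And>a b c e. (a,b,c,e) \<in> gm_columns \<Longrightarrow> 2 * d (a,b,c,e) = s1*a + s2*b + s3*c + s4*e"
    and v: "v \<in> gm_columns" "w \<in> gm_columns" "d v = d w + 1"
  shows "(\<lambda>n. real (card {N \<in> GM_admissible n.
      s1 * vdeg N 0 + s2 * vdeg N 1 + s3 * vdeg N 2 + s4 * vdeg N 3 = 0})
    / real (card (GM_admissible n))) \<longlonglongrightarrow> 0"
proof -
  let ?L = "\<lambda>N. s1 * vdeg N 0 + s2 * vdeg N 1 + s3 * vdeg N 2 + s4 * vdeg N 3"
  have L: "?L N = 2 * (\<Sum>j<n. d (column_fun n N j))" if "N \<in> GM_admissible n" for n N
  proof -
    have N: "N \<in> carrier_mat 4 n" "\<And>j. j < n \<Longrightarrow> column_fun n N j \<in> gm_columns"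
      using that by (auto simp: GM_admissible_iff_columns)
    have "2 * d (column_fun n N j) =
        s1 * N $$ (0,j) + s2 * N $$ (1,j) + s3 * N $$ (2,j) + s4 * N $$ (3,j)" if "j < n" for j
      using N(2)[OF that] that by (simp add: column_fun_def d)
    then show ?thesis
      using N(1) by (simp add: vdeg_def sum_distrib_left sum.distrib)
  qed
  have "card {N \<in> GM_admissible n. ?L N = 0} =
      card {g \<in> {..<n} \<rightarrow>\<^sub>E gm_columns. (\<Sum>j<n. d (g j)) = 0}" for n
  proof (rule bij_betw_same_card[of "column_fun n"])
    show "bij_betw (column_fun n) {N \<in> GM_admissible n. ?L N = 0}
        {g \<in> {..<n} \<rightarrow>\<^sub>E gm_columns. (\<Sum>j<n. d (g j)) = 0}"
    proof (rule bij_betw_Collect[OF bij_betw_column_fun])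
      fix N assume "N \<in> GM_admissible n"
      then show "((\<Sum>j<n. d (column_fun n N j)) = 0) = (?L N = 0)"
        using L by simp
    qed
  qed
  then show ?thesis
    using walk_return_tendsto_0[OF finite_gm_columns v]
    by (simp add: card_GM_admissible card_gm_columns)
qed

text \<open>Union bound over the three ways to split four rows into pairs, followed by a sandwich
  between one minus the three balance probabilities and 1.\<close>

lemma GM_proportion_tendsto_1:
  assumes "\<forall>\<^sub>F n in sequentially. \<forall>N \<in> GM_admissible n. \<not> P n N \<longrightarrow>
    vdeg N 0 + vdeg N 1 = vdeg N 2 + vdeg N 3 \<or>
    vdeg N 0 + vdeg N 2 = vdeg N 1 + vdeg N 3 \<or>
    vdeg N 0 + vdeg N 3 = vdeg N 1 + vdeg N 2"
  shows "(\<lambda>n. real (card {N \<in> GM_admissible n. P n N}) / real (card (GM_admissible n)))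
    \<longlonglongrightarrow> 1"
proof -
  let ?Z = "\<lambda>n s2 s3 s4. {N \<in> GM_admissible n.
      1 * vdeg N 0 + s2 * vdeg N 1 + s3 * vdeg N 2 + s4 * vdeg N 3 = (0::int)}"
  let ?r = "\<lambda>n s2 s3 s4. real (card (?Z n s2 s3 s4)) / real (card (GM_admissible n))"
  \<comment> \<open>For each pairing, \<open>v\<close> has its two ones in the pair with positive
    signs, giving step 1, while the zero column gives step 0.\<close>
  have "(\<lambda>n. ?r n 1 (-1) (-1)) \<longlonglongrightarrow> 0"
    by (rule unbalanced_tendsto_0[where d = "\<lambda>(a,b,c,e). (a + b - c - e) div 2"
          and v = "(1,1,0,0)" and w = "(0,0,0,0)"]) (auto simp: gm_columns_def)
  moreover have "(\<lambda>n. ?r n (-1) 1 (-1)) \<longlonglongrightarrow> 0"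
    by (rule unbalanced_tendsto_0[where d = "\<lambda>(a,b,c,e). (a - b + c - e) div 2"
          and v = "(1,0,1,0)" and w = "(0,0,0,0)"]) (auto simp: gm_columns_def)
  moreover have "(\<lambda>n. ?r n (-1) (-1) 1) \<longlonglongrightarrow> 0"
    by (rule unbalanced_tendsto_0[where d = "\<lambda>(a,b,c,e). (a - b - c + e) div 2"
          and v = "(1,0,0,1)" and w = "(0,0,0,0)"]) (auto simp: gm_columns_def)
  ultimately have "(\<lambda>n. 1 - (?r n 1 (-1) (-1) + ?r n (-1) 1 (-1) + ?r n (-1) (-1) 1))
      \<longlonglongrightarrow> 1 - (0 + 0 + 0)"
    by (intro tendsto_intros)
  then have lower: "(\<lambda>n. 1 - (?r n 1 (-1) (-1) + ?r n (-1) 1 (-1) + ?r n (-1) (-1) 1))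
      \<longlonglongrightarrow> 1"
    by simp
  show ?thesis
  proof (rule tendsto_sandwich[OF _ _ lower tendsto_const])
    have "card {N \<in> GM_admissible n. P n N} \<le> 8 ^ n" for n
      unfolding card_GM_admissible[symmetric] by (intro card_mono finite_GM_admissible) auto
    then have "real (card {N \<in> GM_admissible n. P n N}) / real (card (GM_admissible n)) \<le> 1" for n
      by (simp add: card_GM_admissible flip: of_nat_power)
    then show "\<forall>\<^sub>F n in sequentially. real (card {N \<in> GM_admissible n. P n N})
        / real (card (GM_admissible n)) \<le> 1"
      by (intro always_eventually allI)
    show "\<forall>\<^sub>F n in sequentially. 1 - (?r n 1 (-1) (-1) + ?r n (-1) 1 (-1) + ?r n (-1) (-1) 1)
        \<le> real (card {N \<in> GM_admissible n. P n N}) / real (card (GM_admissible n))"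
      using assms
    proof eventually_elim
      case (elim n)
      let ?A = "{N \<in> GM_admissible n. P n N}"
      have "GM_admissible n \<subseteq> ?A \<union> (?Z n 1 (-1) (-1) \<union> ?Z n (-1) 1 (-1) \<union> ?Z n (-1) (-1) 1)"
      proof
        fix N assume "N \<in> GM_admissible n"
        then show "N \<in> ?A \<union> (?Z n 1 (-1) (-1) \<union> ?Z n (-1) 1 (-1) \<union> ?Z n (-1) (-1) 1)"
          using elim[rule_format, of N] by (cases "P n N") auto
      qed
      then have "card (GM_admissible n) \<le>
          card (?A \<union> (?Z n 1 (-1) (-1) \<union> ?Z n (-1) 1 (-1) \<union> ?Z n (-1) (-1) 1))"
        by (intro card_mono) (auto simp: finite_GM_admissible)
      also have "\<dots> \<le> card ?A + (card (?Z n 1 (-1) (-1)) + card (?Z n (-1) 1 (-1)) + card (?Z n (-1) (-1) 1))"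
        by (intro order_trans[OF card_Un_le] add_mono order_refl)
      finally have "real (card (GM_admissible n)) \<le> real (card ?A) +
          (real (card (?Z n 1 (-1) (-1))) + real (card (?Z n (-1) 1 (-1))) + real (card (?Z n (-1) (-1) 1)))"
        by (simp only: of_nat_add[symmetric] of_nat_le_iff)
      moreover have "1 - (x / g + y / g + z / g) \<le> u / g" if "g \<le> u + (x + y + z)" "g > 0"
        for g u x y z :: real
      proof -
        have "1 \<le> (u + (x + y + z)) / g" using that by simp
        then show ?thesis by (simp add: add_divide_distrib)
      qed
      ultimately show ?case
        by (simp add: card_GM_admissible)
    qed
  qed
qed

section \<open>From equal zeta functions to balanced row sums\<close>

text \<open>Supplies equality of edge counts: the switched row sums total
  \<open>4 * h - 2 * h = 2 * h\<close>, as before, and the column sums do not change.\<close>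

lemma sum_vdeg_block_graph_GM_switch:
  assumes B: "B \<in> carrier_mat 4 4" and C: "C \<in> carrier_mat n n" and N: "N \<in> GM_admissible n"
  shows "(\<Sum>i<4 + n. vdeg (block_graph B (GM_switch N) C) i) = (\<Sum>i<4 + n. vdeg (block_graph B N C) i)"
proof -
  have N4: "N \<in> carrier_mat 4 n" using N by (simp add: GM_admissible_def)
  obtain h where "\<And>i. i < 4 \<Longrightarrow> vdeg (GM_switch N) i = h - vdeg N i" "(\<Sum>i<4. vdeg N i) = 2 * h"
    using GM_row_sums[OF N] by metis
  then have "(\<Sum>i<4. vdeg (GM_switch N) i) = (\<Sum>i<4. vdeg N i)"
    by (simp add: sum_subtractf)
  then show ?thesis
    by (simp add: sum_lessThan_add sum.distrib vdeg_block_graph[OF B N4 C]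
        vdeg_block_graph[OF B GM_switch_carrier[OF N4] C] col_ones_GM_switch[OF N])
qed

lemma col_ones_nonneg: "N \<in> GM_admissible n \<Longrightarrow> j < n \<Longrightarrow> col_ones N j \<ge> 0"
  by (auto simp: GM_admissible_def)

lemma prod_vdeg_block_graph:
  assumes B: "B \<in> carrier_mat 4 4" and k: "\<forall>i<4. vdeg B i = k"
    and C: "C \<in> carrier_mat n n" and N: "N \<in> carrier_mat 4 n"
  shows "(\<Prod>i<4 + n. vdeg (block_graph B N C) i + c) =
    (\<Prod>i<4. k + c + vdeg N i) * (\<Prod>j<n. col_ones N j + vdeg C j + c)"
  unfolding prod_lessThan_add using k
  by (intro arg_cong2[of _ _ _ _ "(*)"] prod.cong) (auto simp: vdeg_block_graph[OF B N C])

text \<open>The shift \<open>c\<close> is \<open>-1\<close> for the graph itself and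
  \<open>0\<close> for its cone. The degree bound \<open>1 - c\<close> makes all factors outside
  \<open>B\<close> positive, so they cancel.\<close>

lemma prod_vdeg_eq_imp_balanced:
  assumes B: "B \<in> carrier_mat 4 4" and k: "\<forall>i<4. vdeg B i = k"
    and C: "C \<in> carrier_mat n n" and N: "N \<in> GM_admissible n"
    and deg: "min_deg_ge C (1 - c)" and c: "k + c \<ge> -1"
    and eq: "(\<Prod>i<4 + n. vdeg (block_graph B N C) i + c) =
      (\<Prod>i<4 + n. vdeg (block_graph B (GM_switch N) C) i + c)"
  shows "vdeg N 0 + vdeg N 1 = vdeg N 2 + vdeg N 3 \<or>
    vdeg N 0 + vdeg N 2 = vdeg N 1 + vdeg N 3 \<or>
    vdeg N 0 + vdeg N 3 = vdeg N 1 + vdeg N 2"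
proof -
  have N4: "N \<in> carrier_mat 4 n" using N by (simp add: GM_admissible_def)
  have "col_ones N j + vdeg C j + c > 0" if "j < n" for j
    using col_ones_nonneg[OF N that] deg C that by (fastforce simp: min_deg_ge_def)
  then have "(\<Prod>j<n. col_ones N j + vdeg C j + c) \<noteq> 0"
    by (force simp: prod_zero_iff)
  moreover have "(\<Prod>i<4. k + c + vdeg N i) * (\<Prod>j<n. col_ones N j + vdeg C j + c) =
      (\<Prod>i<4. k + c + vdeg (GM_switch N) i) * (\<Prod>j<n. col_ones N j + vdeg C j + c)"
    using eq by (simp add: prod_vdeg_block_graph[OF B k C N4]
        prod_vdeg_block_graph[OF B k C GM_switch_carrier[OF N4]] col_ones_GM_switch[OF N])
  ultimately have "(\<Prod>i<4. k + c + vdeg N i) = (\<Prod>i<4. k + c + vdeg (GM_switch N) i)"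
    by simp
  then show ?thesis
    using GM_product_eq_imp_balanced[OF N c] by blast
qed

theorem theorem4p2:
  fixes B :: "int mat"
  assumes "B \<in> carrier_mat 4 4" and "is_adj_mat B" and "is_regular B"
  shows
    "(\<forall>C :: nat \<Rightarrow> int mat.
        (\<forall>\<^sub>F n in sequentially. C n \<in> carrier_mat n n \<and> is_adj_mat (C n) \<and> min_deg_ge (C n) 1) \<longrightarrow>
        (\<lambda>n. real (card {N \<in> GM_admissible n.
                 ihara_zeta (cone (block_graph B N (C n)))
                 \<noteq> ihara_zeta (cone (block_graph B (GM_switch N) (C n)))})
             / real (card (GM_admissible n))) \<longlonglongrightarrow> 1)
   \<and> (\<forall>C :: nat \<Rightarrow> int mat.
        (\<forall>\<^sub>F n in sequentially. C n \<in> carrier_mat n n \<and> is_adj_mat (C n) \<and> min_deg_ge (C n) 2) \<longrightarrow>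
        (\<lambda>n. real (card {N \<in> GM_admissible n.
                 ihara_zeta (block_graph B N (C n))
                 \<noteq> ihara_zeta (block_graph B (GM_switch N) (C n))})
             / real (card (GM_admissible n))) \<longlonglongrightarrow> 1)"
proof -
  note B = assms(1)
  obtain k where k: "\<forall>i<4. vdeg B i = k"
    using assms(3) B by (auto simp: is_regular_def)
  \<comment> \<open>Nonnegativity of the common degree \<open>k\<close> yields
    \<open>k + c \<ge> -1\<close> for both shifts.\<close>
  have "B $$ (0,j) \<ge> 0" if "j < 4" for j
  proof -
    have "B $$ (0,j) \<in> {0,1}"
      using assms(2) B that unfolding is_adj_mat_def by simp
    then show ?thesis by auto
  qed
  then have "vdeg B 0 \<ge> 0"
    unfolding vdeg_def using B by (intro sum_nonneg) auto
  with k have k0: "k \<ge> 0" by simp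
  show ?thesis
  proof (intro conjI allI impI; rule GM_proportion_tendsto_1; elim eventually_mono; intro ballI impI)
    fix C :: "nat \<Rightarrow> int mat" and n N
    assume Cn: "C n \<in> carrier_mat n n \<and> is_adj_mat (C n) \<and> min_deg_ge (C n) 2"
      and N: "N \<in> GM_admissible n"
      and "\<not> ihara_zeta (block_graph B N (C n)) \<noteq> ihara_zeta (block_graph B (GM_switch N) (C n))"
    then have eq: "ihara_zeta (block_graph B N (C n)) = ihara_zeta (block_graph B (GM_switch N) (C n))"
      by simp
    \<comment> \<open>The bound 2 is rewritten to exhibit the shift \<open>c = -1\<close>.\<close>
    from Cn have C: "C n \<in> carrier_mat n n" and deg: "min_deg_ge (C n) (1 - (- 1))" by auto
    note dim = dim_block_graph(1)[OF B C]
    have "num_edges (block_graph B N (C n)) = num_edges (block_graph B (GM_switch N) (C n))"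
      by (simp add: num_edges_def dim sum_vdeg_block_graph_GM_switch[OF B C N])
    then have "(\<Prod>i<4 + n. vdeg (block_graph B N (C n)) i + - 1) =
        (\<Prod>i<4 + n. vdeg (block_graph B (GM_switch N) (C n)) i + - 1)"
      using ihara_zeta_eqD[OF eq] by (simp add: dim)
    then show "vdeg N 0 + vdeg N 1 = vdeg N 2 + vdeg N 3 \<or>
        vdeg N 0 + vdeg N 2 = vdeg N 1 + vdeg N 3 \<or>
        vdeg N 0 + vdeg N 3 = vdeg N 1 + vdeg N 2"
      using k0 by (intro prod_vdeg_eq_imp_balanced[OF B k C N deg]) auto
  next
    fix C :: "nat \<Rightarrow> int mat" and n N
    assume Cn: "C n \<in> carrier_mat n n \<and> is_adj_mat (C n) \<and> min_deg_ge (C n) 1"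
      and N: "N \<in> GM_admissible n"
      and "\<not> ihara_zeta (cone (block_graph B N (C n))) \<noteq>
        ihara_zeta (cone (block_graph B (GM_switch N) (C n)))"
    then have eq: "ihara_zeta (cone (block_graph B N (C n))) =
        ihara_zeta (cone (block_graph B (GM_switch N) (C n)))"
      by simp
    \<comment> \<open>For cones the shift is \<open>c = 0\<close>.\<close>
    from Cn have C: "C n \<in> carrier_mat n n" and deg: "min_deg_ge (C n) (1 - 0)" by auto
    note dim = dim_block_graph[OF B C]
    have square: "block_graph B N' (C n) \<in> carrier_mat (4 + n) (4 + n)" for N'
      using dim by (intro carrier_matI)
    have vdeg: "(\<Sum>i<dim_row (cone (block_graph B N' (C n))). vdeg (cone (block_graph B N' (C n))) i) =
        (\<Sum>i<4 + n. vdeg (block_graph B N' (C n)) i) + 2 * int (4 + n)"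
      "(\<Prod>i<dim_row (cone (block_graph B N' (C n))). vdeg (cone (block_graph B N' (C n))) i - 1) =
        (\<Prod>i<4 + n. vdeg (block_graph B N' (C n)) i + 0) * (int (4 + n) - 1)" for N'
      by (simp_all only: sum_vdeg_cone[OF square] prod_vdeg_cone[OF square] add_0_right)
    have "num_edges (cone (block_graph B N (C n))) = num_edges (cone (block_graph B (GM_switch N) (C n)))"
      by (simp only: num_edges_def vdeg sum_vdeg_block_graph_GM_switch[OF B C N])
    moreover have "dim_row (cone (block_graph B N (C n))) = dim_row (cone (block_graph B (GM_switch N) (C n)))"
      by (simp add: dim_cone dim)
    ultimately have "(\<Prod>i<4 + n. vdeg (block_graph B N (C n)) i + 0) * (int (4 + n) - 1) =
        (\<Prod>i<4 + n. vdeg (block_graph B (GM_switch N) (C n)) i + 0) * (int (4 + n) - 1)"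
      using ihara_zeta_eqD[OF eq] unfolding vdeg by blast
    \<comment> \<open>The apex factor equals \<open>n + 3\<close>, which is nonzero and can be
      cancelled.\<close>
    then have "(\<Prod>i<4 + n. vdeg (block_graph B N (C n)) i + 0) =
        (\<Prod>i<4 + n. vdeg (block_graph B (GM_switch N) (C n)) i + 0)"
      by (subst (asm) mult_cancel_right) auto
    then show "vdeg N 0 + vdeg N 1 = vdeg N 2 + vdeg N 3 \<or>
        vdeg N 0 + vdeg N 2 = vdeg N 1 + vdeg N 3 \<or>
        vdeg N 0 + vdeg N 3 = vdeg N 1 + vdeg N 2"
      using k0 by (intro prod_vdeg_eq_imp_balanced[OF B k C N deg]) auto
  qed
qed

end
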